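(* Let $\alpha_1,\beta_1$ be real numbers. The double inequality $$\alpha_1H(a,b)+(1-\alpha_1)Q(a,b)<M(a,b)<\beta_1H(a,b)+(1-\beta_1)Q(a,b)$$ holds for all $a,b>0$ with $a\neq b$ if and only if $\alpha_1\geq \frac{2}{9}=0.2222\cdots$ and $\beta_1\leq 1-\frac{1}{\sqrt{2}\log(1+\sqrt{2})}=0.1977\cdots$.
   Context: For real numbers $a,b>0$ with $a\neq b$: the harmonic mean is $H(a,b)=\frac{2ab}{a+b}$; the quadratic mean is $Q(a,b)=\sqrt{\frac{a^2+b^2}{2}}$; the Neuman-Sándor mean is $M(a,b)=\frac{a-b}{2\sinh^{-1}\left(\frac{a-b}{a+b}\right)}$, where $\sinh^{-1}(x)=\log(x+\sqrt{1+x^2})$ is the inverse hyperbolic sine function. Here $\log$ is the natural logarithm. *)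

theory Defs
  imports Complex_Main
begin

definition harmonic_mean :: "real \<Rightarrow> real \<Rightarrow> real" where
  "harmonic_mean a b = 2 * a * b / (a + b)"

definition quadratic_mean :: "real \<Rightarrow> real \<Rightarrow> real" where
  "quadratic_mean a b = sqrt ((a\<^sup>2 + b\<^sup>2) / 2)"

text \<open>
  The Neuman--Sandor mean. The formula is only meaningful for a \<open>\<noteq>\<close> b; on the diagonal
  it takes the junk value 0 instead of the usual continuous extension a.
\<close>
definition neuman_sandor_mean :: "real \<Rightarrow> real \<Rightarrow> real" where
  "neuman_sandor_mean a b = (a - b) / (2 * arsinh ((a - b) / (a + b)))"

end

theory Submission
  imports Defs
begin

text \<open>
  Write \<open>A = (a + b) / 2\<close> and put \<open>sinh t = (a - b) / (a + b)\<close>. Then the three means are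
  \<open>H = A (1 - sinh\<^sup>2 t)\<close>, \<open>Q = A cosh t\<close> and \<open>M = A sinh t / t\<close>. Since \<open>H < Q\<close>, the double
  inequality says that the quotient
  \<open>(Q - M) / (Q - H) = (cosh t - sinh t / t) / (cosh t - 1 + sinh\<^sup>2 t)\<close>
  lies strictly between \<open>\<beta>\<^sub>1\<close> and \<open>\<alpha>\<^sub>1\<close>, so the best constants are the bounds of this
  quotient over the values that \<open>t\<close> can take.

  Numerator and denominator are even power series in \<open>t\<close> without constant term. After division
  by \<open>t\<^sup>2\<close> they become power series in \<open>x = t\<^sup>2\<close> with positive coefficients, and the quotient
  of the coefficients,
  \<open>(2 k + 2) / ((2 k + 3) (1 + 2\<^bsup>2 k + 1\<^esup>))\<close>, decreases in \<open>k\<close>. A quotient of power series with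
  this property is itself strictly decreasing (\<open>powser_quotient_strict_decreasing\<close>), and it is
  continuous on \<open>[0, \<infinity>)\<close>, including the point \<open>x = 0\<close> that the equality \<open>a = b\<close> would give.

  The values of \<open>x\<close> that occur form exactly the open interval from \<open>0\<close> to \<open>(arsinh 1)\<^sup>2\<close>
  (\<open>arsinh_param_range\<close>). A strictly decreasing continuous function on such an interval lies
  strictly between \<open>\<beta>\<^sub>1\<close> and \<open>\<alpha>\<^sub>1\<close> iff its two endpoint values lie weakly between them
  (\<open>bounds_strict_decreasing_iff\<close>). The endpoint values are \<open>2 / 9\<close> at \<open>0\<close>, the quotient of the
  first coefficients, and \<open>1 - 1 / (sqrt 2 ln (1 + sqrt 2))\<close> at the other end.
\<close>

section \<open>Quotients of power series\<close>

lemma powser_pos: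
  fixes b :: "nat \<Rightarrow> real"
  assumes "\<And>k. b k > 0" "x \<ge> 0" "summable (\<lambda>k. b k * x ^ k)"
  shows "(\<Sum>k. b k * x ^ k) > 0"
  using assms(3)
proof (rule suminf_pos2[where i = 0])
  show "0 \<le> b k * x ^ k" for k using assms(1)[of k] assms(2) by simp
  show "0 < b 0 * x ^ 0" using assms(1)[of 0] by simp
qed

text \<open>
  Let \<open>c\<close> be the quotient at \<open>y\<close>, so that the series with coefficients \<open>e k = a k - c * b k\<close>
  vanishes at \<open>y\<close>. As \<open>a k / b k\<close> decreases, the \<open>e k\<close> change sign once, from nonnegative to
  negative; let \<open>m\<close> be the first index with \<open>e m < 0\<close>. Passing from \<open>y\<close> to
  \<open>x = q * y\<close> multiplies the \<open>k\<close>-th term by \<open>q ^ k\<close>. Compared with the uniform factor \<open>q ^ m\<close>, this favours the nonnegative terms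
  (\<open>k < m\<close>) and shrinks the negative ones, so the series is positive at \<open>x\<close>.
\<close>
lemma powser_quotient_strict_decreasing:
  fixes a b :: "nat \<Rightarrow> real"
  assumes b: "\<And>k. b k > 0"
    and quot: "\<And>j k. j < k \<Longrightarrow> a k / b k < a j / b j"
    and xy: "0 \<le> x" "x < y"
    and suma: "summable (\<lambda>k. a k * y ^ k)"
    and sumb: "summable (\<lambda>k. b k * y ^ k)"
  shows "(\<Sum>k. a k * y ^ k) / (\<Sum>k. b k * y ^ k) < (\<Sum>k. a k * x ^ k) / (\<Sum>k. b k * x ^ k)"
proof -
  have summ: "summable (\<lambda>k. a k * z ^ k)" "summable (\<lambda>k. b k * z ^ k)" if "z \<in> {x, y}" for z
    using that suma sumb powser_inside[OF suma, of x] powser_inside[OF sumb, of x] xy by auto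
  have Bpos: "(\<Sum>k. b k * z ^ k) > 0" if "z \<in> {x, y}" for z
    using b _ summ(2)[OF that] by (rule powser_pos) (use that xy in auto)
  define c where "c = (\<Sum>k. a k * y ^ k) / (\<Sum>k. b k * y ^ k)"
  define e where "e k = a k - c * b k" for k
  have e_sums: "(\<lambda>k. e k * z ^ k) sums ((\<Sum>k. a k * z ^ k) - c * (\<Sum>k. b k * z ^ k))"
    if "z \<in> {x, y}" for z
  proof -
    have "(\<lambda>k. a k * z ^ k - c * (b k * z ^ k)) sums ((\<Sum>k. a k * z ^ k) - c * (\<Sum>k. b k * z ^ k))"
      by (intro sums_diff sums_mult summable_sums summ that)
    then show ?thesis by (simp add: e_def algebra_simps)
  qed
  have y: "y > 0" using xy by simp
  have e_y: "(\<lambda>k. e k * y ^ k) sums 0"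
    using e_sums[of y] Bpos[of y] y by (simp add: c_def)
  have e_neg: "e k < 0" if "j < k" "e j \<le> 0" for j k
  proof -
    have "a j / b j \<le> c" using that(2) b[of j] by (simp add: e_def field_simps)
    then have "a k / b k < c" using quot[OF that(1)] by simp
    then show ?thesis using b[of k] by (simp add: e_def field_simps)
  qed
  have e0: "e 0 > 0"
  proof (rule ccontr)
    assume "\<not> e 0 > 0"
    then have neg: "e k \<le> 0" for k by (cases k) (use e_neg[of 0 k] in auto)
    have "0 < (\<Sum>k. - (e k * y ^ k))"
    proof (rule suminf_pos2[where i = 1])
      show "summable (\<lambda>k. - (e k * y ^ k))" using e_y by (simp add: sums_iff summable_minus)
      show "0 \<le> - (e k * y ^ k)" for k using neg[of k] y by (simp add: mult_nonpos_nonneg)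
      show "0 < - (e 1 * y ^ 1)" using e_neg[of 0 1] neg[of 0] y by (simp add: mult_neg_pos)
    qed
    then show False using e_y by (simp add: sums_iff suminf_minus)
  qed
  have "\<exists>k. e k < 0"
  proof (rule ccontr)
    assume "\<nexists>k. e k < 0"
    then have pos: "e k \<ge> 0" for k by (meson not_less)
    have "0 < (\<Sum>k. e k * y ^ k)"
      by (rule suminf_pos2[where i = 0]) (use e_y pos e0 y in \<open>auto simp: sums_iff\<close>)
    then show False using e_y by (simp add: sums_iff)
  qed
  then obtain m where m: "e m < 0" and before_m: "\<And>k. k < m \<Longrightarrow> e k \<ge> 0"
    using exists_least_iff[of "\<lambda>k. e k < 0"] by (metis not_less)
  have m0: "m > 0" using m e0 by (cases m) auto
  define q where "q = x / y"
  have q: "0 \<le> q" "q < 1" "x = q * y" using xy by (auto simp: q_def)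
  \<comment> \<open>Subtracting \<open>q ^ m\<close> times the series at \<open>y\<close> changes nothing, because that series is zero;
    afterwards every term is nonnegative.\<close>
  have diff_sums: "(\<lambda>k. e k * y ^ k * (q ^ k - q ^ m)) sums
      ((\<Sum>k. a k * x ^ k) - c * (\<Sum>k. b k * x ^ k))"
    using sums_diff[OF e_sums[of x] sums_mult[OF e_y, of "q ^ m"]]
    by (simp add: q(3) algebra_simps power_mult_distrib)
  have "0 < (\<Sum>k. e k * y ^ k * (q ^ k - q ^ m))"
  proof (rule suminf_pos2[where i = 0])
    show "summable (\<lambda>k. e k * y ^ k * (q ^ k - q ^ m))" using diff_sums by (simp add: sums_iff)
    show "0 \<le> e k * y ^ k * (q ^ k - q ^ m)" for k
    proof (cases "k < m")
      case True
      then show ?thesis using before_m[OF True] y q by (simp add: power_decreasing)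
    next
      case False
      then have "e k \<le> 0" using m e_neg[of m k] by (cases "k = m") auto
      moreover have "q ^ k \<le> q ^ m" using False q by (simp add: power_decreasing)
      ultimately show ?thesis using y by (simp add: mult_nonpos_nonneg mult_nonpos_nonpos)
    qed
    show "0 < e 0 * y ^ 0 * (q ^ 0 - q ^ m)" using e0 q m0 by (simp add: power_less_one_iff)
  qed
  then have "c * (\<Sum>k. b k * x ^ k) < (\<Sum>k. a k * x ^ k)"
    using diff_sums by (simp add: sums_iff)
  then show ?thesis using Bpos[of x] by (simp add: c_def[symmetric] pos_less_divide_eq)
qed

text \<open>
  Strict bounds on the open interval become weak bounds at its endpoints by passing to the limit;
  conversely, strict monotonicity turns the weak bounds at the endpoints into strict ones inside.
\<close>
lemma bounds_strict_decreasing_iff: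
  fixes g :: "real \<Rightarrow> real"
  assumes "0 < X" and cont: "isCont g 0" "isCont g X"
    and dec: "\<And>x y. 0 \<le> x \<Longrightarrow> x < y \<Longrightarrow> g y < g x"
  shows "(\<forall>x. 0 < x \<and> x < X \<longrightarrow> g x < \<alpha> \<and> \<beta> < g x) \<longleftrightarrow> g 0 \<le> \<alpha> \<and> \<beta> \<le> g X"
proof
  assume bound: "\<forall>x. 0 < x \<and> x < X \<longrightarrow> g x < \<alpha> \<and> \<beta> < g x"
  have "\<forall>\<^sub>F x in at_right 0. g x \<le> \<alpha>"
    using eventually_at_right_real[OF \<open>0 < X\<close>]
    by eventually_elim (use bound in \<open>auto intro: less_imp_le\<close>)
  moreover have "(g \<longlongrightarrow> g 0) (at_right 0)"
    using cont(1) by (simp add: isCont_def filterlim_at_split)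
  ultimately have "g 0 \<le> \<alpha>" by (intro tendsto_upperbound) auto
  moreover have "\<forall>\<^sub>F x in at_left X. \<beta> \<le> g x"
    using eventually_at_left_real[OF \<open>0 < X\<close>]
    by eventually_elim (use bound in \<open>auto intro: less_imp_le\<close>)
  moreover have "(g \<longlongrightarrow> g X) (at_left X)"
    using cont(2) by (simp add: isCont_def filterlim_at_split)
  ultimately show "g 0 \<le> \<alpha> \<and> \<beta> \<le> g X"
    using tendsto_lowerbound[of g "g X" "at_left X" \<beta>] by auto
next
  assume "g 0 \<le> \<alpha> \<and> \<beta> \<le> g X"
  then show "\<forall>x. 0 < x \<and> x < X \<longrightarrow> g x < \<alpha> \<and> \<beta> < g x"
    using dec by (meson less_imp_le less_le_trans le_less_trans order_refl)
qed

section \<open>The hyperbolic quotient as a quotient of power series\<close>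

text \<open>
  The coefficients, in powers of \<open>t\<^sup>2\<close>, of \<open>(cosh t - sinh t / t) / t\<^sup>2\<close>, which belongs to the gap
  between the quadratic and the Neuman--Sandor mean; see \<open>gap_M_sums\<close>.
\<close>
definition gap_coeff_M :: "nat \<Rightarrow> real" where
  "gap_coeff_M k = (2 * real k + 2) / fact (2 * k + 3)"

text \<open>
  Likewise for \<open>(cosh t - (1 - sinh\<^sup>2 t)) / t\<^sup>2\<close>, which belongs to the gap between the quadratic and
  the harmonic mean; see \<open>gap_H_sums\<close>.
\<close>
definition gap_coeff_H :: "nat \<Rightarrow> real" where
  "gap_coeff_H k = (1 + 2 ^ (2 * k + 1)) / fact (2 * k + 2)"

lemma cosh_even_sums: "(\<lambda>k. t ^ (2 * k) / fact (2 * k)) sums cosh (t :: real)"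
proof -
  have "(\<lambda>k. (if even (2 * k) then t ^ (2 * k) /\<^sub>R fact (2 * k) else 0)) sums cosh t"
    by (subst sums_mono_reindex[where g = "\<lambda>k. 2 * k"])
       (use cosh_converges[of t] in \<open>auto simp: strict_mono_def elim!: evenE\<close>)
  then show ?thesis by (simp add: divide_inverse_commute)
qed

lemma sinh_odd_sums: "(\<lambda>k. t ^ (2 * k + 1) / fact (2 * k + 1)) sums sinh (t :: real)"
proof -
  have "(\<lambda>k. (if even (2 * k + 1) then 0 else t ^ (2 * k + 1) /\<^sub>R fact (2 * k + 1))) sums sinh t"
    by (subst sums_mono_reindex[where g = "\<lambda>k. 2 * k + 1"])
       (use sinh_converges[of t] in \<open>auto simp: strict_mono_def elim!: oddE\<close>)
  then show ?thesis by (simp add: divide_inverse_commute del: power_Suc fact_Suc)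
qed

lemma fact_odd: "fact (2 * k + 3) = (2 * real k + 3) * fact (2 * k + 2)"
  using fact_Suc[of "2 * k + 2", where 'a = real] by (simp add: numeral_3_eq_3 del: fact_Suc)

text \<open>
  The constant terms of \<open>cosh t\<close> and \<open>sinh t / t\<close> cancel, which leaves room for the division
  by \<open>t\<^sup>2\<close>.
\<close>
lemma gap_M_sums:
  assumes "t \<noteq> 0"
  shows "(\<lambda>k. gap_coeff_M k * (t\<^sup>2) ^ k) sums ((cosh t - sinh t / t) / t\<^sup>2)"
proof -
  define f where "f k = t ^ (2 * k) / fact (2 * k) - t ^ (2 * k + 1) / fact (2 * k + 1) / t" for k
  have "f sums (cosh t - sinh t / t)"
    unfolding f_def by (intro sums_diff sums_divide cosh_even_sums sinh_odd_sums)
  moreover have "f 0 = 0" using assms by (simp add: f_def)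
  ultimately have "(\<lambda>k. f (Suc k)) sums (cosh t - sinh t / t)" by (simp add: sums_Suc_iff)
  then have "(\<lambda>k. f (Suc k) / t\<^sup>2) sums ((cosh t - sinh t / t) / t\<^sup>2)" by (rule sums_divide)
  moreover have "f (Suc k) / t\<^sup>2 = gap_coeff_M k * (t\<^sup>2) ^ k" for k
  proof -
    have "f (Suc k) = t ^ (2 * k + 2) * (1 / fact (2 * k + 2) - 1 / fact (2 * k + 3))"
      using assms by (simp add: f_def numeral_3_eq_3 field_simps del: fact_Suc)
    also have "1 / fact (2 * k + 2) - 1 / fact (2 * k + 3) = gap_coeff_M k"
      unfolding gap_coeff_M_def fact_odd by (simp add: divide_simps del: fact_Suc)
    finally show ?thesis using assms
      by (simp add: power_add power_mult field_simps power2_eq_square)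
  qed
  ultimately show ?thesis by simp
qed

text \<open>
  Rewriting \<open>sinh\<^sup>2 t\<close> as \<open>(cosh (2 t) - 1) / 2\<close> avoids squaring a series.
\<close>
lemma gap_H_sums:
  assumes "t \<noteq> 0"
  shows "(\<lambda>k. gap_coeff_H k * (t\<^sup>2) ^ k) sums ((cosh t - (1 - (sinh t)\<^sup>2)) / t\<^sup>2)"
proof -
  define f where "f k = t ^ (2 * k) / fact (2 * k) + (2 * t) ^ (2 * k) / fact (2 * k) / 2" for k
  have "f sums (cosh t + cosh (2 * t) / 2)"
    unfolding f_def by (intro sums_add sums_divide cosh_even_sums)
  moreover have "f 0 = 3 / 2" by (simp add: f_def)
  ultimately have "(\<lambda>k. f (Suc k)) sums (cosh t + cosh (2 * t) / 2 - 3 / 2)"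
    by (simp only: sums_Suc_iff diff_add_cancel)
  also have "cosh t + cosh (2 * t) / 2 - 3 / 2 = cosh t - (1 - (sinh t)\<^sup>2)"
  proof -
    have "cosh (2 * t) = 2 * (sinh t)\<^sup>2 + 1" by (simp add: cosh_double cosh_square_eq)
    then show ?thesis by (simp add: add_divide_distrib)
  qed
  finally have "(\<lambda>k. f (Suc k) / t\<^sup>2) sums ((cosh t - (1 - (sinh t)\<^sup>2)) / t\<^sup>2)" by (rule sums_divide)
  moreover have "f (Suc k) / t\<^sup>2 = gap_coeff_H k * (t\<^sup>2) ^ k" for k
    using assms
    by (simp add: f_def gap_coeff_H_def power_mult_distrib power_mult power2_eq_square divide_simps
        del: fact_Suc)
       (simp add: algebra_simps)
  ultimately show ?thesis by simp
qed

text \<open>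
  The expansions above are at squares of nonzero numbers; the point \<open>\<bar>z\<bar> + 1\<close> is such a square,
  and convergence there gives convergence at the smaller \<open>z\<close>, which may be zero or negative.
\<close>
lemma gap_summable:
  shows "summable (\<lambda>k. gap_coeff_M k * z ^ k)" and "summable (\<lambda>k. gap_coeff_H k * z ^ k)"
proof -
  have t: "sqrt (\<bar>z\<bar> + 1) \<noteq> 0" "(sqrt (\<bar>z\<bar> + 1))\<^sup>2 = \<bar>z\<bar> + 1" by auto
  show "summable (\<lambda>k. gap_coeff_M k * z ^ k)"
    by (rule powser_inside[where x = "\<bar>z\<bar> + 1"])
       (use gap_M_sums[OF t(1)] in \<open>auto simp only: t(2) sums_iff\<close>, simp)
  show "summable (\<lambda>k. gap_coeff_H k * z ^ k)"
    by (rule powser_inside[where x = "\<bar>z\<bar> + 1"])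
       (use gap_H_sums[OF t(1)] in \<open>auto simp only: t(2) sums_iff\<close>, simp)
qed

lemma gap_coeff_H_pos: "gap_coeff_H k > 0"
  by (simp add: gap_coeff_H_def add_pos_pos del: fact_Suc)

text \<open>
  It suffices to compare neighbours. Passing from \<open>n\<close> to \<open>n + 1\<close> multiplies the factor
  \<open>1 + 2 ^ (2 * n + 1)\<close> in the denominator by at least three, which outweighs the small increase of
  \<open>(2 n + 2) / (2 n + 3)\<close>.
\<close>
lemma gap_coeff_quotient_decreasing:
  assumes "j < k"
  shows "gap_coeff_M k / gap_coeff_H k < gap_coeff_M j / gap_coeff_H j"
proof -
  have quot: "gap_coeff_M n / gap_coeff_H n =
      (2 * real n + 2) / ((2 * real n + 3) * (1 + 2 ^ (2 * n + 1)))" for n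
    by (simp add: gap_coeff_M_def gap_coeff_H_def fact_odd del: fact_Suc)
  have "- (gap_coeff_M n / gap_coeff_H n) < - (gap_coeff_M (Suc n) / gap_coeff_H (Suc n))" for n
  proof -
    define P :: real where "P = 2 ^ (2 * n + 1)"
    have P: "P \<ge> 1" unfolding P_def by (rule one_le_power) simp
    have PS: "2 ^ (2 * Suc n + 1) = 4 * P" by (simp add: P_def)
    \<comment> \<open>The common part of \<open>(2n+4)(2n+3) = u + 12\<close> and \<open>(2n+2)(2n+5) = u + 10\<close>, which
      arise from cross-multiplication.\<close>
    define u where "u = 4 * (real n)\<^sup>2 + 14 * real n"
    have "0 \<le> u * P" using P by (simp add: u_def)
    then have "(u + 12) * (1 + P) < (u + 10) * (1 + 4 * P)"
      using P by (simp add: algebra_simps)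
    then have "(2 * real n + 4) * ((2 * real n + 3) * (1 + P)) <
        (2 * real n + 2) * ((2 * real n + 5) * (1 + 4 * P))"
      by (simp add: u_def algebra_simps power2_eq_square)
    then have "(2 * real n + 4) / ((2 * real n + 5) * (1 + 4 * P)) <
        (2 * real n + 2) / ((2 * real n + 3) * (1 + P))"
      using P by (simp add: divide_less_eq less_divide_eq pos_divide_less_eq mult_pos_pos mult.commute)
    then show ?thesis unfolding quot PS P_def[symmetric] by (simp add: add.commute)
  qed
  then show ?thesis
    using lift_Suc_mono_less[of "\<lambda>n. - (gap_coeff_M n / gap_coeff_H n)", OF _ assms] by simp
qed

text \<open>
  For \<open>x = t\<^sup>2 > 0\<close> this is \<open>(Q - M) / (Q - H)\<close>. Defining it by the series, rather than by the
  hyperbolic functions, gives it the limit as value at \<open>x = 0\<close>.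
\<close>
definition gap_quotient :: "real \<Rightarrow> real" where
  "gap_quotient x = (\<Sum>k. gap_coeff_M k * x ^ k) / (\<Sum>k. gap_coeff_H k * x ^ k)"

lemma gap_quotient_decreasing:
  "0 \<le> x \<Longrightarrow> x < y \<Longrightarrow> gap_quotient y < gap_quotient x"
  unfolding gap_quotient_def
  by (rule powser_quotient_strict_decreasing)
     (auto intro: gap_coeff_H_pos gap_coeff_quotient_decreasing gap_summable)

lemma isCont_gap_quotient:
  assumes "x \<ge> 0"
  shows "isCont gap_quotient x"
proof -
  have "0 < (\<Sum>k. gap_coeff_H k * x ^ k)"
    using gap_coeff_H_pos assms gap_summable(2) by (rule powser_pos)
  then show ?thesis
    unfolding gap_quotient_def
    by (intro isCont_divide isCont_powser_converges_everywhere gap_summable) auto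
qed

lemma gap_quotient_0: "gap_quotient 0 = 2 / 9"
  unfolding gap_quotient_def powser_zero by (simp add: gap_coeff_M_def gap_coeff_H_def fact_numeral)

lemma gap_quotient_hyperbolic:
  assumes "t \<noteq> 0"
  shows "gap_quotient (t\<^sup>2) = (cosh t - sinh t / t) / (cosh t - (1 - (sinh t)\<^sup>2))"
  using gap_M_sums[OF assms] gap_H_sums[OF assms] assms
  by (simp add: gap_quotient_def sums_iff)

lemma gap_quotient_endpoint:
  "gap_quotient ((arsinh 1)\<^sup>2) = 1 - 1 / (sqrt 2 * ln (1 + sqrt 2))"
proof -
  have "arsinh (1 :: real) \<noteq> 0" by simp
  then have "gap_quotient ((arsinh 1)\<^sup>2) = (sqrt 2 - 1 / arsinh 1) / sqrt 2"
    by (simp add: gap_quotient_hyperbolic cosh_arsinh_real)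
  also have "\<dots> = 1 - 1 / (sqrt 2 * arsinh 1)" by (simp add: field_simps)
  moreover have "arsinh 1 = ln (1 + sqrt (2 :: real))" by (simp add: arsinh_real_def)
  ultimately show ?thesis by simp
qed

section \<open>Means in hyperbolic coordinates\<close>

lemma means_hyperbolic:
  fixes a b :: real
  assumes ab: "a > 0" "b > 0"
  defines "A \<equiv> (a + b) / 2" and "t \<equiv> arsinh ((a - b) / (a + b))"
  shows "harmonic_mean a b = A * (1 - (sinh t)\<^sup>2)"
    and "quadratic_mean a b = A * cosh t"
    and "neuman_sandor_mean a b = A * (sinh t / t)"
proof -
  have A: "A > 0" using ab by (simp add: A_def)
  have A2: "2 * A = a + b" by (simp add: A_def)
  have st: "sinh t = (a - b) / (2 * A)" unfolding A2 by (simp add: t_def)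
  have ct: "cosh t = sqrt (((a - b) / (2 * A))\<^sup>2 + 1)" unfolding A2 by (simp add: t_def cosh_arsinh_real)
  show "harmonic_mean a b = A * (1 - (sinh t)\<^sup>2)"
  proof -
    have "A * (1 - ((a - b) / (2 * A))\<^sup>2) = (A\<^sup>2 - (a - b)\<^sup>2 / 4) / A"
      using A by (simp add: power_divide power_mult_distrib field_simps power2_eq_square power4_eq_xxxx)
    also have "A\<^sup>2 - (a - b)\<^sup>2 / 4 = a * b" by (simp add: A_def field_simps power2_eq_square)
    finally have "A * (1 - ((a - b) / (2 * A))\<^sup>2) = a * b / A" .
    moreover have "harmonic_mean a b = a * b / A"
      by (simp add: harmonic_mean_def A_def)
    ultimately show ?thesis by (simp only: st)
  qed
  have "A\<^sup>2 * ((a - b) / (2 * A))\<^sup>2 = (a - b)\<^sup>2 / 4"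
    using A by (simp add: power_divide power_mult_distrib)
  moreover have "(a\<^sup>2 + b\<^sup>2) / 2 = (a - b)\<^sup>2 / 4 + A\<^sup>2"
    by (simp add: A_def field_simps power2_eq_square)
  ultimately have "(a\<^sup>2 + b\<^sup>2) / 2 = A\<^sup>2 * (((a - b) / (2 * A))\<^sup>2 + 1)"
    by (simp only: distrib_left mult_1_right)
  then show "quadratic_mean a b = A * cosh t"
    using A by (simp add: quadratic_mean_def ct real_sqrt_mult)
  show "neuman_sandor_mean a b = A * (sinh t / t)"
    using A by (simp add: neuman_sandor_mean_def st t_def[symmetric])
qed

text \<open>
  Both inequalities are linear in the constant, and the coefficient \<open>Q - H = A * D\<close> is positive;
  solving for the constant gives the quotient.
\<close>
lemma mean_bounds_iff_gap_quotient:
  fixes a b :: real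
  assumes ab: "a > 0" "b > 0" "a \<noteq> b"
  defines "t \<equiv> arsinh ((a - b) / (a + b))"
  shows "\<alpha> * harmonic_mean a b + (1 - \<alpha>) * quadratic_mean a b < neuman_sandor_mean a b
      \<longleftrightarrow> gap_quotient (t\<^sup>2) < \<alpha>"
    and "neuman_sandor_mean a b < \<beta> * harmonic_mean a b + (1 - \<beta>) * quadratic_mean a b
      \<longleftrightarrow> \<beta> < gap_quotient (t\<^sup>2)"
proof -
  define A where "A = (a + b) / 2"
  have A: "A > 0" using ab by (simp add: A_def)
  have t: "t \<noteq> 0" using ab by (simp add: t_def)
  define D where "D = cosh t - (1 - (sinh t)\<^sup>2)"
  have "(sinh t)\<^sup>2 > 0" using t by simp
  then have D: "D > 0" using cosh_real_ge_1[of t] unfolding D_def by linarith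
  note means = means_hyperbolic[OF ab(1,2), folded t_def A_def]
  note quot = gap_quotient_hyperbolic[OF t, folded D_def]
  have combo: "c * harmonic_mean a b + (1 - c) * quadratic_mean a b = A * (cosh t - c * D)" for c
    by (simp add: means D_def algebra_simps)
  show "\<alpha> * harmonic_mean a b + (1 - \<alpha>) * quadratic_mean a b < neuman_sandor_mean a b
      \<longleftrightarrow> gap_quotient (t\<^sup>2) < \<alpha>"
    unfolding combo means(3) quot mult_less_cancel_left_pos[OF A] pos_divide_less_eq[OF D]
    by linarith
  show "neuman_sandor_mean a b < \<beta> * harmonic_mean a b + (1 - \<beta>) * quadratic_mean a b
      \<longleftrightarrow> \<beta> < gap_quotient (t\<^sup>2)"
    unfolding combo means(3) quot mult_less_cancel_left_pos[OF A] pos_less_divide_eq[OF D]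
    by linarith
qed

text \<open>
  The ratio \<open>(a - b) / (a + b)\<close> takes every nonzero value in \<open>(-1, 1)\<close>: the value \<open>s\<close> comes from
  \<open>a = 1 + s\<close> and \<open>b = 1 - s\<close>. Squaring makes the sign of \<open>a - b\<close> disappear.
\<close>
lemma arsinh_param_range:
  "{(arsinh ((a - b) / (a + b)))\<^sup>2 | a b :: real. a > 0 \<and> b > 0 \<and> a \<noteq> b} = {0<..<(arsinh 1)\<^sup>2}"
proof (intro equalityI subsetI)
  fix x assume "x \<in> {(arsinh ((a - b) / (a + b)))\<^sup>2 | a b :: real. a > 0 \<and> b > 0 \<and> a \<noteq> b}"
  then obtain a b :: real where ab: "a > 0" "b > 0" "a \<noteq> b"
    and x: "x = (arsinh ((a - b) / (a + b)))\<^sup>2" by auto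
  define s where "s = (a - b) / (a + b)"
  have s: "- 1 < s" "s < 1" "s \<noteq> 0" using ab by (auto simp: s_def field_simps)
  have "arsinh s < arsinh 1" "arsinh (-1) < arsinh s"
    using s by (simp_all del: arsinh_minus_real)
  then have "\<bar>arsinh s\<bar> < \<bar>arsinh 1\<bar>" unfolding arsinh_minus_real by linarith
  then have "(arsinh s)\<^sup>2 < (arsinh 1)\<^sup>2" by (rule power2_strict_mono)
  then show "x \<in> {0<..<(arsinh 1)\<^sup>2}" using s by (simp add: x s_def)
next
  fix x :: real assume x: "x \<in> {0<..<(arsinh 1)\<^sup>2}"
  have "sqrt x < sqrt ((arsinh 1)\<^sup>2)" using x by (intro real_sqrt_less_mono) simp
  moreover have "arsinh (1 :: real) > 0" by simp
  ultimately have "sqrt x < arsinh 1" by (simp only: real_sqrt_abs abs_of_pos)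
  then have "sinh (sqrt x) < sinh (arsinh 1)" by (simp only: sinh_real_less_iff)
  then have s: "0 < sinh (sqrt x)" "sinh (sqrt x) < 1" using x by simp_all
  define s where "s = sinh (sqrt x)"
  have "x = (arsinh s)\<^sup>2" using x by (simp add: s_def arsinh_sinh_real)
  then have "x = (arsinh (((1 + s) - (1 - s)) / ((1 + s) + (1 - s))))\<^sup>2" by simp
  moreover have "1 + s > 0" "1 - s > 0" "1 + s \<noteq> 1 - s" using s by (simp_all add: s_def[symmetric])
  ultimately show "x \<in> {(arsinh ((a - b) / (a + b)))\<^sup>2 | a b :: real. a > 0 \<and> b > 0 \<and> a \<noteq> b}"
    by blast
qed

theorem theorem1p1:
  fixes \<alpha>\<^sub>1 \<beta>\<^sub>1 :: real
  shows "(\<forall>a b :: real. a > 0 \<and> b > 0 \<and> a \<noteq> b \<longrightarrow>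
            \<alpha>\<^sub>1 * harmonic_mean a b + (1 - \<alpha>\<^sub>1) * quadratic_mean a b < neuman_sandor_mean a b \<and>
            neuman_sandor_mean a b < \<beta>\<^sub>1 * harmonic_mean a b + (1 - \<beta>\<^sub>1) * quadratic_mean a b)
         \<longleftrightarrow> \<alpha>\<^sub>1 \<ge> 2 / 9 \<and> \<beta>\<^sub>1 \<le> 1 - 1 / (sqrt 2 * ln (1 + sqrt 2))" (is "?lhs \<longleftrightarrow> _")
proof -
  let ?range = "{(arsinh ((a - b) / (a + b)))\<^sup>2 | a b :: real. a > 0 \<and> b > 0 \<and> a \<noteq> b}"
  have "?lhs \<longleftrightarrow> (\<forall>x \<in> ?range. gap_quotient x < \<alpha>\<^sub>1 \<and> \<beta>\<^sub>1 < gap_quotient x)"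
    by (auto simp: mean_bounds_iff_gap_quotient)
  also have "\<dots> \<longleftrightarrow> (\<forall>x. 0 < x \<and> x < (arsinh 1)\<^sup>2 \<longrightarrow> gap_quotient x < \<alpha>\<^sub>1 \<and> \<beta>\<^sub>1 < gap_quotient x)"
    unfolding arsinh_param_range by auto
  also have "\<dots> \<longleftrightarrow> gap_quotient 0 \<le> \<alpha>\<^sub>1 \<and> \<beta>\<^sub>1 \<le> gap_quotient ((arsinh 1)\<^sup>2)"
    by (rule bounds_strict_decreasing_iff)
       (auto intro: isCont_gap_quotient gap_quotient_decreasing)
  finally show ?thesis unfolding gap_quotient_0 gap_quotient_endpoint .
qed

end
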